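(* For a satellite at altitude $h$ and slant range $s_t$ relative to the cluster center, the CDF $F^{t}_{\chi,\mathrm{M}}(x)=\Pr[|\chi_t|\le x]$ of the Doppler shift magnitude $|\chi_t|$ within a cluster of radius $\rho$ with a uniform UE (user equipment) distribution is given by $$F^{t}_{\chi,\mathrm{M}}(x)=F_{\mathrm{M}}\!\left(\frac{hx}{\sqrt{A^2-x^2}},\ \rho\ \Big|\ \hat R_t\right),$$ where $A=\frac{f_c\, r_o\,(\omega_s+\omega_E\cos[\theta_i])}{c}$, $\hat R_t=\sqrt{s_t^2-h^2}$, and $$F_{\mathrm{M}}(r,R\,|\,\hat R)=\begin{cases}\frac{r^2}{R^2}, & 0\le r\le R-\hat R,\\[2pt] \frac{r^2}{\pi R^2}\left(\theta^*-\tfrac12\sin(2\theta^* )\right)+\frac1\pi\left(\phi^*-\tfrac12\sin(2\phi^* )\right), & |R-\hat R|<r\le R+\hat R,\end{cases}$$ with $\theta^*=\cos^{-1}\!\left[\frac{r^2+\hat R^2-R^2}{2\hat R r}\right]$ and $\phi^*=\cos^{-1}\!\left[\frac{R^2+\hat R^2-r^2}{2\hat R R}\right]$.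
   Context: A circular-orbit LEO (low earth orbit) satellite at altitude $h$ serves stationary UEs. UE locations are approximated to lie on a plane $\mathbb{P}$ instead of a spherical surface. The cluster served at time $t$ is a disk of radius $\rho$ in $\mathbb{P}$ about a cluster center, and a random UE of the cluster is uniformly distributed in this disk. The slant range $s_t$ is the distance at time $t$ from the satellite to the cluster center. The sub-satellite point is the projection of the satellite location on $\mathbb{P}$, so $\hat R_t$ is its distance from the cluster center. The satellite location at time $t$ and the cluster center are given (the CDF is conditional on them). $F_{\mathrm{M}}(r,R\,|\,\hat R)$ is the CDF, at $r$, of the distance between a point uniformly distributed in a circle (disk) of radius $R$ and a fixed point of the same plane (inside or outside the circle) at distance $\hat R$ from the circle's center. Parameters: $f_c$ is the carrier frequency, $c$ the speed of light, $r_E$ the earth radius, $r_o=r_E+h$ the orbital radius, $\omega_s$ and $\omega_E$ the angular velocities of the satellite and the earth in the earth-centered inertial frame, $\theta_i$ the orbital inclination of the satellite relative to the equatorial plane, and $\omega_F$ the satellite angular velocity in the earth-centered fixed frame, approximated as $\omega_F\approx\omega_s+\omega_E\cos[\theta_i]$. Doppler shift: $\chi_t$ is the Doppler frequency shift at time $t$ at a random UE of the cluster, due to satellite motion. For every UE it is characterized by the expression $\chi_t=-\frac{f_c\,r_E\,\omega_F\,\cos[\alpha_t]}{c}$, where $\alpha_t$ is the elevation angle from the UE to the satellite. This is the Doppler formula for a UE on the satellite's ground track; for a UE outside the orbital plane its magnitude is an upper bound on the Doppler shift magnitude, and it is used for all UEs as a simplifying approximation.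
   Formalization: The elevation angle is taken at the point of the spherical earth whose line of sight to the satellite crosses the plane at the uniform UE location (all such points assumed to exist); measured above the plane itself, the claim would need r_E instead of r_o in A. *)

theory Defs
  imports "HOL-Probability.Probability"
begin

text \<open>
  Space is \<open>(real^2) \<times> real\<close>: a location in the plane P together with a signed height above P,
  so that P itself is the set of points \<open>(u, 0)\<close>.
\<close>

type_synonym plane = "real^2"
type_synonym space = "plane \<times> real"

text \<open>
  Elevation angle of the target \<open>s\<close> seen from \<open>q\<close>, in \<open>[-pi/2, pi/2]\<close>: the angle between the line
  of sight \<open>s - q\<close> and the local horizontal plane at \<open>q\<close>, i.e. the plane orthogonal to the radius
  from the earth centre \<open>e\<close> to \<open>q\<close>.
\<close>

definition elevation_angle :: "space \<Rightarrow> space \<Rightarrow> space \<Rightarrow> real" where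
  "elevation_angle e q s = arcsin (((q - e) \<bullet> (s - q)) / (norm (q - e) * norm (s - q)))"

definition doppler_shift :: "real \<Rightarrow> real \<Rightarrow> real \<Rightarrow> real \<Rightarrow> real \<Rightarrow> real" where
  "doppler_shift f_c c r_E \<omega>_F \<alpha> = - (f_c * r_E * \<omega>_F * cos \<alpha> / c)"

text \<open>
  \<open>F_M r R Rh\<close> is the CDF at \<open>r\<close> of the distance between a uniformly distributed point of a disk of
  radius \<open>R\<close> and a fixed point at distance \<open>Rh\<close> from its centre. By invariance of Lebesgue measure
  under isometries it does not matter which disk and which such point are taken; here the disk is
  centred at the origin and the fixed point lies on the first axis.
\<close>

definition F_M :: "real \<Rightarrow> real \<Rightarrow> real \<Rightarrow> real" where
  "F_M r R Rh =
     cdf (distr (uniform_measure lborel (cball (0::plane) R)) borel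
            (\<lambda>u. dist u (vector [Rh, 0]))) r"

definition theta_star :: "real \<Rightarrow> real \<Rightarrow> real \<Rightarrow> real" where
  "theta_star r R Rh = arccos ((r\<^sup>2 + Rh\<^sup>2 - R\<^sup>2) / (2 * Rh * r))"

definition phi_star :: "real \<Rightarrow> real \<Rightarrow> real \<Rightarrow> real" where
  "phi_star r R Rh = arccos ((R\<^sup>2 + Rh\<^sup>2 - r\<^sup>2) / (2 * Rh * R))"

end

(*
  Write d for the distance of X from the sub-satellite point. The law of sines in the triangle earth
  centre - UE - satellite gives r_E cos alpha = r_o sin(nadir angle) with sin(nadir angle) =
  d / sqrt(d^2 + h^2), so |chi| = |A| d / sqrt(d^2 + h^2), which is increasing in d; solving
  |chi| <= x for d gives the radius h x / sqrt(A^2 - x^2). The radical axis cuts the intersection of two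
  discs into two circular segments, whose areas are integrals of chord lengths.
*)
theory Submission
  imports Defs
begin

section \<open>Areas of circular segments\<close>

text \<open>This makes Fubini available for areas in \<open>real^2\<close>. Lebesgue measure is
  determined by its values on boxes, and the preimage of a box is a product of two open
  intervals.\<close>

lemma lborel_plane:
  "(lborel :: plane measure) = distr (lborel \<Otimes>\<^sub>M lborel) borel (\<lambda>(x, y). vector [x, y])"
proof (rule lborel_eqI)
  let ?f = "\<lambda>(x::real, y::real). vector [x, y] :: plane"
  have "?f = (\<lambda>p. fst p *\<^sub>R axis 1 1 + snd p *\<^sub>R axis 2 1)"
    by (auto simp: fun_eq_iff vec_eq_iff forall_2 axis_def)
  then have f: "?f \<in> borel_measurable (lborel \<Otimes>\<^sub>M lborel)"
    by simp
  fix l u :: plane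
  assume le: "\<And>b. b \<in> Basis \<Longrightarrow> l \<bullet> b \<le> u \<bullet> b"
  have "l $ i \<le> u $ i" for i
    using le[of "axis i 1"] by (simp add: inner_axis)
  moreover have "?f -` box l u \<inter> space (lborel \<Otimes>\<^sub>M lborel) = {l$1<..<u$1} \<times> {l$2<..<u$2}"
    by (auto simp: space_pair_measure mem_box_cart forall_2)
  moreover have "(\<Prod>b\<in>Basis. (u - l) \<bullet> b) = (u $ 1 - l $ 1) * (u $ 2 - l $ 2)"
  proof -
    have Basis: "(Basis :: plane set) = {axis 1 1, axis 2 1}"
      by (auto simp: Basis_vec_def UNIV_2)
    show ?thesis unfolding Basis by (simp add: axis_eq_axis inner_axis)
  qed
  ultimately show "emeasure (distr (lborel \<Otimes>\<^sub>M lborel) borel ?f) (box l u) = (\<Prod>b\<in>Basis. (u - l) \<bullet> b)"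
    using f by (simp add: emeasure_distr lborel.emeasure_pair_measure_Times ennreal_mult)
qed simp

text \<open>The integrand is the length of the chord of the circle of radius \<open>R\<close> at
  abscissa \<open>x\<close>, so the value is the area of the segment to the right of
  \<open>a\<close>.\<close>

lemma has_integral_chord_length:
  assumes "R > 0" "- R \<le> a" "a \<le> R"
  shows "((\<lambda>x. 2 * sqrt (R\<^sup>2 - x\<^sup>2)) has_integral
           R\<^sup>2 * arccos (a / R) - a * sqrt (R\<^sup>2 - a\<^sup>2)) {a..R}"
proof -
  define F where "F = (\<lambda>x. x * sqrt (R\<^sup>2 - x\<^sup>2) - R\<^sup>2 * arccos (x / R))"
  have "((\<lambda>x. 2 * sqrt (R\<^sup>2 - x\<^sup>2)) has_integral F R - F a) {a..R}"
  \<comment> \<open>The square root and \<open>arccos\<close> in \<open>F\<close> have no finite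
    derivative at the ends of the diameter, so \<open>F\<close> is differentiated in the open
    interval only and is merely continuous at its ends.\<close>
  proof (rule fundamental_theorem_of_calculus_interior)
    show "continuous_on {a..R} F"
      unfolding F_def using assms
      by (intro continuous_intros) (auto simp: field_simps)
    fix x assume "x \<in> {a<..<R}"
    with assms have x: "- R < x" "x < R" by auto
    then have lt: "x\<^sup>2 < R\<^sup>2"
      by (metis abs_less_iff minus_less_iff real_sqrt_abs real_sqrt_less_iff abs_of_pos \<open>R > 0\<close>)
    have "- 1 < x / R" "x / R < 1"
      using x \<open>R > 0\<close> by (auto simp: field_simps)
    moreover have "sqrt (1 - (x / R)\<^sup>2) = sqrt (R\<^sup>2 - x\<^sup>2) / R"
      using \<open>R > 0\<close> by (simp add: power_divide diff_divide_eq_iff real_sqrt_divide)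
    moreover have "sqrt (R\<^sup>2 - x\<^sup>2) * sqrt (R\<^sup>2 - x\<^sup>2) = R\<^sup>2 - x\<^sup>2" "sqrt (R\<^sup>2 - x\<^sup>2) > 0"
      using lt by simp_all
    ultimately have "(F has_field_derivative 2 * sqrt (R\<^sup>2 - x\<^sup>2)) (at x)"
      unfolding F_def using \<open>R > 0\<close> lt
      by (auto intro!: derivative_eq_intros simp: field_simps power2_eq_square)
    then show "(F has_vector_derivative 2 * sqrt (R\<^sup>2 - x\<^sup>2)) (at x)"
      by (simp add: has_real_derivative_iff_has_vector_derivative)
  qed (use assms in simp)
  then show ?thesis
    using assms by (simp add: F_def)
qed

text \<open>Cavalieri: the vertical slice at \<open>x\<close> is a chord with half-length
  \<open>sqrt (R\<^sup>2 - x\<^sup>2)\<close>, and the area is the integral of the chord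
  lengths.\<close>

lemma emeasure_disc_cap:
  assumes "R > 0" "- R \<le> a" "a \<le> R"
  shows "emeasure lborel {u::plane. u \<in> cball 0 R \<and> a \<le> u $ 1} =
         ennreal (R\<^sup>2 * arccos (a / R) - a * sqrt (R\<^sup>2 - a\<^sup>2))"
proof -
  let ?f = "\<lambda>(x::real, y::real). vector [x, y] :: plane"
  let ?C = "{u::plane. u \<in> cball 0 R \<and> a \<le> u $ 1}"
  let ?P = "{p::real \<times> real. (fst p)\<^sup>2 + (snd p)\<^sup>2 \<le> R\<^sup>2 \<and> a \<le> fst p}"
  have "?f = (\<lambda>p. fst p *\<^sub>R axis 1 1 + snd p *\<^sub>R axis 2 1)"
    by (auto simp: fun_eq_iff vec_eq_iff forall_2 axis_def)
  then have f: "?f \<in> borel_measurable (lborel \<Otimes>\<^sub>M lborel)"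
    by simp
  have C: "?C \<in> sets borel"
  proof -
    have "?C = cball 0 R \<inter> {u. a \<le> u \<bullet> axis 1 1}"
      by (auto simp: inner_axis)
    then show ?thesis by simp
  qed
  have norm: "norm (vector [x, y] :: plane) \<le> R \<longleftrightarrow> x\<^sup>2 + y\<^sup>2 \<le> R\<^sup>2" for x y
    using \<open>R > 0\<close> by (simp add: norm_vec_def L2_set_def sum_2 real_sqrt_le_iff')
  have "emeasure lborel ?C = emeasure (lborel \<Otimes>\<^sub>M lborel) ?P"
    using f C by (subst lborel_plane) (auto simp: emeasure_distr space_pair_measure norm intro!: arg_cong[where f = "emeasure _"])
  also have "\<dots> = (\<integral>\<^sup>+x. emeasure lborel (Pair x -` ?P) \<partial>lborel)"
  proof (rule lborel.emeasure_pair_measure_alt)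
    have "{p \<in> space (lborel \<Otimes>\<^sub>M lborel). p \<in> ?P} \<in> sets (lborel \<Otimes>\<^sub>M lborel)"
      unfolding mem_Collect_eq by measurable
    then show "?P \<in> sets (lborel \<Otimes>\<^sub>M lborel)"
      by (simp add: space_pair_measure)
  qed
  also have "\<dots> = (\<integral>\<^sup>+x. ennreal (2 * sqrt (R\<^sup>2 - x\<^sup>2)) * indicator {a..R} x \<partial>lborel)"
  proof (rule nn_integral_cong)
    fix x :: real
    show "emeasure lborel (Pair x -` ?P) = ennreal (2 * sqrt (R\<^sup>2 - x\<^sup>2)) * indicator {a..R} x"
    proof (cases "x \<in> {a..R}")
      case True
      then have "x\<^sup>2 \<le> R\<^sup>2" using assms by (intro abs_le_square_iff[THEN iffD1]) auto
      have slice: "x\<^sup>2 + y\<^sup>2 \<le> R\<^sup>2 \<longleftrightarrow> - sqrt (R\<^sup>2 - x\<^sup>2) \<le> y \<and> y \<le> sqrt (R\<^sup>2 - x\<^sup>2)" for y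
      proof -
        have "x\<^sup>2 + y\<^sup>2 \<le> R\<^sup>2 \<longleftrightarrow> \<bar>y\<bar> \<le> sqrt (R\<^sup>2 - x\<^sup>2)"
          by (subst real_sqrt_abs[symmetric], subst real_sqrt_le_iff) auto
        then show ?thesis by (auto simp: abs_le_iff)
      qed
      have "Pair x -` ?P = {y. x\<^sup>2 + y\<^sup>2 \<le> R\<^sup>2}"
        using True by auto
      also have "\<dots> = {- sqrt (R\<^sup>2 - x\<^sup>2)..sqrt (R\<^sup>2 - x\<^sup>2)}"
        unfolding slice by (auto simp only: mem_Collect_eq atLeastAtMost_iff)
      finally have "Pair x -` ?P = {- sqrt (R\<^sup>2 - x\<^sup>2)..sqrt (R\<^sup>2 - x\<^sup>2)}" .
      then show ?thesis using True \<open>x\<^sup>2 \<le> R\<^sup>2\<close> by simp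
    next
      case False
      \<comment> \<open>Outside \<open>{a..R}\<close> the slice is empty: the half-plane excludes
        \<open>x < a\<close>, the disc excludes \<open>x > R\<close>.\<close>
      have "x \<le> R" if "x\<^sup>2 + y\<^sup>2 \<le> R\<^sup>2" for y
      proof (rule power2_le_imp_le)
        show "x\<^sup>2 \<le> R\<^sup>2" using that zero_le_power2[of y] by linarith
      qed (use \<open>R > 0\<close> in simp)
      with False have empty: "Pair x -` ?P = {}" by auto
      show ?thesis unfolding empty using False by simp
    qed
  qed
  also have "\<dots> = ennreal (R\<^sup>2 * arccos (a / R) - a * sqrt (R\<^sup>2 - a\<^sup>2))"
  proof (rule nn_integral_has_integral_lebesgue'[OF _ has_integral_chord_length[OF assms]])
    fix x assume "x \<in> {a..R}"
    then have "x\<^sup>2 \<le> R\<^sup>2" using assms by (intro abs_le_square_iff[THEN iffD1]) auto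
    then show "0 \<le> 2 * sqrt (R\<^sup>2 - x\<^sup>2)" by simp
  qed
  finally show ?thesis .
qed

text \<open>With \<open>t = R * cos \<phi>\<close> one has
  \<open>sqrt (R\<^sup>2 - t\<^sup>2) = R * sin \<phi>\<close>, and the double angle formula turns
  the area into its trigonometric form.\<close>

lemma content_disc_cap:
  assumes "R > 0" "- R \<le> t" "t \<le> R"
  shows "measure lborel {u::plane. u \<in> cball 0 R \<and> t \<le> u $ 1} =
         R\<^sup>2 * (arccos (t / R) - 1 / 2 * sin (2 * arccos (t / R)))"
proof -
  \<comment> \<open>\<open>ennreal\<close> truncates negative reals to 0, so the sign is needed to
    read off the real value.\<close>
  have "0 \<le> R\<^sup>2 * arccos (t / R) - t * sqrt (R\<^sup>2 - t\<^sup>2)"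
  proof (rule has_integral_nonneg[OF has_integral_chord_length[OF assms]])
    fix x assume "x \<in> {t..R}"
    then have "x\<^sup>2 \<le> R\<^sup>2" using assms by (intro abs_le_square_iff[THEN iffD1]) auto
    then show "0 \<le> 2 * sqrt (R\<^sup>2 - x\<^sup>2)" by simp
  qed
  then have "measure lborel {u::plane. u \<in> cball 0 R \<and> t \<le> u $ 1} =
      R\<^sup>2 * arccos (t / R) - t * sqrt (R\<^sup>2 - t\<^sup>2)"
    using emeasure_disc_cap[OF assms] by (simp add: measure_def)
  moreover have "- 1 \<le> t / R" "t / R \<le> 1"
    using assms by (auto simp: field_simps)
  moreover have "sqrt (1 - (t / R)\<^sup>2) = sqrt (R\<^sup>2 - t\<^sup>2) / R"
    using \<open>R > 0\<close> by (simp add: power_divide diff_divide_eq_iff real_sqrt_divide)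
  ultimately show ?thesis
    using \<open>R > 0\<close> by (simp add: sin_double sin_arccos) (simp add: field_simps power2_eq_square)
qed

section \<open>Intersection of two discs\<close>

text \<open>A translation followed by an orthogonal map carries one pair of centres to the other,
  and both preserve measure. The invariance is used for \<open>lebesgue\<close> and returned to
  \<open>lborel\<close>, with which it agrees on Borel sets.\<close>

lemma content_Int_cball_congruent:
  fixes a b a' b' :: "real^'n::{finite,wellorder}"
  assumes "dist a b = dist a' b'"
  shows "measure lborel (cball a R \<inter> cball b r) = measure lborel (cball a' R \<inter> cball b' r)"
proof -
  have centred: "measure lebesgue (cball x R \<inter> cball y r) = measure lebesgue (cball 0 R \<inter> cball (y - x) r)"
    for x y :: "real^'n::{finite,wellorder}"
  proof -
    have "cball x R \<inter> cball y r = (+) x ` (cball 0 R \<inter> cball (y - x) r)"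
      using cball_translation[of x 0 R] cball_translation[of x "y - x" r]
      by (simp add: image_Int)
    then show ?thesis by (simp add: measure_translation)
  qed
  obtain T where T: "orthogonal_transformation T" "T (b - a) = b' - a'"
    using orthogonal_transformation_exists[of "b - a" "b' - a'"] assms
    by (metis dist_commute dist_norm)
  have "T ` (cball 0 R \<inter> cball (b - a) r) = T ` cball 0 R \<inter> T ` cball (b - a) r"
    by (rule image_Int) (simp add: T orthogonal_transformation_inj)
  also have "\<dots> = cball 0 R \<inter> cball (b' - a') r"
    using T by (simp add: image_orthogonal_transformation_cball linear_0 orthogonal_transformation_linear)
  finally have "measure lebesgue (cball 0 R \<inter> cball (b' - a') r) = measure lebesgue (cball 0 R \<inter> cball (b - a) r)"
    using measure_orthogonal_image[OF T(1), of "cball 0 R \<inter> cball (b - a) r"]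
    by (simp add: lmeasurable_compact compact_Int_closed)
  with centred[of a b] centred[of a' b'] show ?thesis
    by (simp add: measure_completion)
qed

text \<open>Frees \<open>F_M\<close> from its standard position. A negative \<open>r\<close> is
  covered too: \<open>cball b r\<close> is then empty and both sides vanish.\<close>

lemma F_M_eq_measure:
  assumes "R > 0" and "dist a b = \<bar>Rh\<bar>"
  shows "F_M r R Rh = measure lborel (cball (a::plane) R \<inter> cball b r) / (pi * R\<^sup>2)"
proof -
  have area: "emeasure lborel (cball (0::plane) R) = ennreal (pi * R\<^sup>2)"
    using \<open>R > 0\<close> by (simp add: emeasure_cball unit_ball_vol_numeral eval_unit_ball_vol)
  have dist: "dist 0 (vector [Rh, 0] :: plane) = \<bar>Rh\<bar>"
    by (simp add: norm_vec_def L2_set_def sum_2)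
  have "(\<lambda>u. dist u (vector [Rh, 0] :: plane)) -` {..r} = cball (vector [Rh, 0]) r"
    by (auto simp: dist_commute)
  then have "F_M r R Rh = measure (uniform_measure lborel (cball 0 R)) (cball (vector [Rh, 0] :: plane) r)"
    unfolding F_M_def cdf_def by (subst measure_distr) auto
  also have "\<dots> = measure lborel (cball 0 R \<inter> cball (vector [Rh, 0] :: plane) r) / (pi * R\<^sup>2)"
    using \<open>R > 0\<close> by (subst measure_uniform_measure) (auto simp: area measure_def)
  finally show ?thesis
    using content_Int_cball_congruent[of a b 0 "vector [Rh, 0] :: plane" R r] assms dist by simp
qed


text \<open>\<open>a\<close> and \<open>b\<close> are the signed distances of the radical axis from
  the two centres, each counted towards the other centre. A negative value means that the segment
  exceeds a half disc.\<close>

lemma content_lens: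
  assumes "R > 0" "Rh > 0" "\<bar>R - Rh\<bar> < r" "r \<le> R + Rh"
  defines "a \<equiv> (R\<^sup>2 + Rh\<^sup>2 - r\<^sup>2) / (2 * Rh)" and "b \<equiv> (r\<^sup>2 + Rh\<^sup>2 - R\<^sup>2) / (2 * Rh)"
  shows "measure lborel (cball (0::plane) R \<inter> cball (vector [Rh, 0]) r) =
           R\<^sup>2 * (arccos (a / R) - 1 / 2 * sin (2 * arccos (a / R))) +
           r\<^sup>2 * (arccos (b / r) - 1 / 2 * sin (2 * arccos (b / r)))"
proof -
  define c :: plane where "c = vector [Rh, 0]"
  have "r > 0" using assms by linarith
  have ab: "a + b = Rh"
    using \<open>Rh > 0\<close> by (simp add: a_def b_def field_simps power2_eq_square)
  \<comment> \<open>These are triangle inequalities for sides \<open>R\<close>, \<open>r\<close>,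
    \<open>Rh\<close>; expanded, they place the radical axis within reach of both discs.\<close>
  have sq: "(R - Rh)\<^sup>2 \<le> r\<^sup>2" "r\<^sup>2 \<le> (R + Rh)\<^sup>2" "(r - Rh)\<^sup>2 \<le> R\<^sup>2" "R\<^sup>2 \<le> (r + Rh)\<^sup>2"
    using assms by (auto intro!: abs_le_square_iff[THEN iffD1])
  have a: "- R \<le> a" "a \<le> R" and b: "- r \<le> b" "b \<le> r"
    using sq \<open>Rh > 0\<close> by (auto simp: a_def b_def field_simps power2_eq_square)
  let ?A = "{u::plane. u \<in> cball 0 R \<and> a \<le> u $ 1}"
  let ?B = "{u::plane. u \<in> cball 0 r \<and> b \<le> u $ 1}"
  \<comment> \<open>The map \<open>u \<mapsto> c - u\<close> is the point reflection in the midpoint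
    of the centres. It carries a cap of a disc about 0 to the segment of the disc about
    \<open>c\<close>, so \<open>content_disc_cap\<close> serves for both.\<close>
  let ?B' = "(\<lambda>u. (-1) *\<^sub>R u + c) ` ?B"
  have B': "?B' = {u. u \<in> cball c r \<and> u $ 1 \<le> a}"
  proof (intro equalityI subsetI)
    fix u assume "u \<in> {u. u \<in> cball c r \<and> u $ 1 \<le> a}"
    then have "c - u \<in> ?B" using ab by (simp add: dist_norm c_def)
    then show "u \<in> ?B'" by (rule rev_image_eqI) simp
  next
    fix u assume "u \<in> ?B'"
    then show "u \<in> {u. u \<in> cball c r \<and> u $ 1 \<le> a}"
      using ab by (auto simp: dist_norm c_def)
  qed
  \<comment> \<open>\<open>u $ 1 = a\<close> is the radical axis of the two circles: on either side of it, one disc lies inside the other.\<close>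
  have power: "(norm (u - c))\<^sup>2 - r\<^sup>2 = (norm u)\<^sup>2 - R\<^sup>2 + 2 * Rh * (a - u $ 1)" for u
  proof -
    have "(norm v)\<^sup>2 = (v $ 1)\<^sup>2 + (v $ 2)\<^sup>2" for v :: plane
      by (simp add: norm_vec_def L2_set_def sum_2)
    then show ?thesis
      using \<open>Rh > 0\<close> by (simp add: a_def c_def field_simps power2_eq_square)
  qed
  have in_R: "u \<in> cball 0 R \<longleftrightarrow> (norm u)\<^sup>2 \<le> R\<^sup>2" for u :: plane
    using \<open>R > 0\<close> by (auto simp: abs_le_square_iff[symmetric])
  have in_r: "u \<in> cball c r \<longleftrightarrow> (norm (u - c))\<^sup>2 \<le> r\<^sup>2" for u
    using \<open>r > 0\<close> by (auto simp: abs_le_square_iff[symmetric] dist_norm norm_minus_commute)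
  have lens: "cball 0 R \<inter> cball c r = ?A \<union> ?B'"
  proof -
    have "u \<in> cball 0 R \<inter> cball c r \<longleftrightarrow> u \<in> ?A \<or> u \<in> cball c r \<and> u $ 1 \<le> a" for u
    proof (cases "a \<le> u $ 1")
      case True
      then have "2 * Rh * (a - u $ 1) \<le> 0"
        using \<open>Rh > 0\<close> by (simp add: mult_le_0_iff)
      with True power[of u] show ?thesis unfolding Int_iff mem_Collect_eq in_R in_r
        by (cases "u $ 1 = a") auto
    next
      case False
      then have "2 * Rh * (a - u $ 1) \<ge> 0"
        using \<open>Rh > 0\<close> by simp
      with False power[of u] show ?thesis unfolding Int_iff mem_Collect_eq in_R in_r
        by auto
    qed
    then show ?thesis unfolding B' by blast
  qed
  have half: "{u::plane. t \<le> u $ 1} = {u. t \<le> u \<bullet> axis 1 1}" "{u::plane. u $ 1 \<le> t} = {u. u \<bullet> axis 1 1 \<le> t}" for t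
    by (auto simp: inner_axis)
  have A_eq: "?A = cball 0 R \<inter> {u. a \<le> u $ 1}" and B'_eq: "?B' = cball c r \<inter> {u. u $ 1 \<le> a}"
    and B_eq: "?B = cball 0 r \<inter> {u. b \<le> u $ 1}"
    unfolding B' by auto
  have borel_A: "?A \<in> sets borel" unfolding A_eq half by auto
  have borel_B: "?B \<in> sets borel" unfolding B_eq half by auto
  have borel_B': "?B' \<in> sets borel" unfolding B'_eq half by auto
  have fm: "?A \<in> lmeasurable" "?B' \<in> lmeasurable"
    unfolding A_eq B'_eq half
    by (auto intro!: lmeasurable_compact compact_Int_closed closed_halfspace_component_le closed_halfspace_component_ge
        simp: axis_in_Basis_iff)
  \<comment> \<open>The two segments meet only on the radical axis, a null set, so their areas
    add.\<close>
  have "negligible {u::plane. u \<bullet> axis 1 1 = a}"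
    by (rule negligible_standard_hyperplane) simp
  then have "AE u in lebesgue. u \<notin> ?A \<or> u \<notin> ?B'"
    unfolding B' negligible_iff_null_sets by (rule AE_I') (auto simp: inner_axis)
  then have "measure lebesgue (?A \<union> ?B') = measure lebesgue ?A + measure lebesgue ?B'"
    using fm by (rule measure_Un_AE)
  moreover have "measure lebesgue ?B' = measure lebesgue ?B"
    using measure_lebesgue_affine[of "-1" c ?B] by (simp add: add.commute cong: image_cong_simp)
  ultimately have "measure lborel (?A \<union> ?B') = measure lborel ?A + measure lborel ?B"
    using borel_A borel_B borel_B' by (simp add: measure_completion)
  then show ?thesis
    using lens content_disc_cap[OF \<open>R > 0\<close> a] content_disc_cap[OF \<open>r > 0\<close> b] by (simp add: c_def)
qed

section \<open>Closed form of \<open>F_M\<close>\<close>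

text \<open>The disc of radius \<open>r\<close> lies inside the disc of radius \<open>R\<close>,
  which leaves a ratio of two disc areas.\<close>

lemma F_M_inner:
  assumes "R > 0" "Rh \<ge> 0" "0 \<le> r" "r \<le> R - Rh"
  shows "F_M r R Rh = r\<^sup>2 / R\<^sup>2"
proof -
  let ?c = "vector [Rh, 0] :: plane"
  have d: "dist 0 ?c = \<bar>Rh\<bar>"
    by (simp add: norm_vec_def L2_set_def sum_2)
  then have "cball ?c r \<subseteq> cball 0 R"
    using assms by (subst cball_subset_cball_iff) (auto simp: dist_commute)
  then have "cball 0 R \<inter> cball ?c r = cball ?c r"
    by auto
  moreover have "measure lborel (cball ?c r) = pi * r\<^sup>2"
    using \<open>0 \<le> r\<close> by (simp add: content_cball eval_unit_ball_vol)
  ultimately show ?thesis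
    using F_M_eq_measure[OF \<open>R > 0\<close> d, of r] by simp
qed

text \<open>The angles are half the openings of the two segments: \<open>theta_star\<close> is seen
  from the fixed point, \<open>phi_star\<close> from the centre of the disc of radius
  \<open>R\<close>.\<close>

lemma F_M_lens:
  assumes "R > 0" "Rh \<ge> 0" "\<bar>R - Rh\<bar> < r" "r \<le> R + Rh"
  shows "F_M r R Rh =
           r\<^sup>2 / (pi * R\<^sup>2) * (theta_star r R Rh - 1 / 2 * sin (2 * theta_star r R Rh))
           + 1 / pi * (phi_star r R Rh - 1 / 2 * sin (2 * phi_star r R Rh))"
proof -
  \<comment> \<open>\<open>Rh = 0\<close> would give \<open>R < r\<close> and
    \<open>r \<le> R\<close>, so the divisions by \<open>Rh\<close> are genuine.\<close>
  have "Rh > 0" "r > 0" using assms by (auto simp: less_le)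
  define a where "a = (R\<^sup>2 + Rh\<^sup>2 - r\<^sup>2) / (2 * Rh)"
  define b where "b = (r\<^sup>2 + Rh\<^sup>2 - R\<^sup>2) / (2 * Rh)"
  have star: "theta_star r R Rh = arccos (b / r)" "phi_star r R Rh = arccos (a / R)"
    by (simp_all add: theta_star_def phi_star_def a_def b_def mult.commute)
  have "dist 0 (vector [Rh, 0] :: plane) = \<bar>Rh\<bar>"
    by (simp add: norm_vec_def L2_set_def sum_2)
  then have "F_M r R Rh = measure lborel (cball (0::plane) R \<inter> cball (vector [Rh, 0]) r) / (pi * R\<^sup>2)"
    by (rule F_M_eq_measure[OF \<open>R > 0\<close>])
  also have "\<dots> = (R\<^sup>2 * (arccos (a / R) - 1 / 2 * sin (2 * arccos (a / R))) +
      r\<^sup>2 * (arccos (b / r) - 1 / 2 * sin (2 * arccos (b / r)))) / (pi * R\<^sup>2)"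
    using content_lens[OF \<open>R > 0\<close> \<open>Rh > 0\<close> assms(3,4)]
    by (simp add: a_def b_def)
  finally show ?thesis
    unfolding star using \<open>R > 0\<close> by (simp add: add_divide_distrib)
qed

section \<open>Elevation angle and Doppler magnitude\<close>

text \<open>The law of sines without coordinates: the square root is twice the area of the triangle
  \<open>e\<close>, \<open>q\<close>, \<open>s\<close>, which can be computed from the sides at
  \<open>q\<close> or from those at \<open>s\<close>.\<close>

lemma cos_elevation_angle:
  assumes "q \<noteq> e" "s \<noteq> q"
  shows "cos (elevation_angle e q s) =
    sqrt ((norm (s - e))\<^sup>2 * (norm (s - q))\<^sup>2 - ((s - e) \<bullet> (s - q))\<^sup>2) / (norm (q - e) * norm (s - q))"
proof -
  let ?y = "((q - e) \<bullet> (s - q)) / (norm (q - e) * norm (s - q))"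
  have pos: "norm (q - e) * norm (s - q) > 0"
    using assms by simp
  have "\<bar>?y\<bar> \<le> 1"
    using pos Cauchy_Schwarz_ineq2[of "q - e" "s - q"] by (simp add: abs_mult)
  then have "cos (elevation_angle e q s) = sqrt (1 - ?y\<^sup>2)"
    unfolding elevation_angle_def abs_le_iff by (intro cos_arcsin) linarith+
  also have "1 - ?y\<^sup>2 = ((norm (q - e))\<^sup>2 * (norm (s - q))\<^sup>2 - ((q - e) \<bullet> (s - q))\<^sup>2) / (norm (q - e) * norm (s - q))\<^sup>2"
    using assms by (simp add: power_divide power_mult_distrib diff_divide_distrib)
  also have "(norm (q - e))\<^sup>2 * (norm (s - q))\<^sup>2 - ((q - e) \<bullet> (s - q))\<^sup>2 =
      (norm (s - e))\<^sup>2 * (norm (s - q))\<^sup>2 - ((s - e) \<bullet> (s - q))\<^sup>2"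
  proof -
    \<comment> \<open>The Gram determinant of two vectors does not change when one is subtracted
      from the other.\<close>
    have "(norm (a - b))\<^sup>2 * (norm b)\<^sup>2 - ((a - b) \<bullet> b)\<^sup>2 = (norm a)\<^sup>2 * (norm b)\<^sup>2 - (a \<bullet> b)\<^sup>2"
      for a b :: space
    proof -
      have "(norm (a - b))\<^sup>2 = (norm a)\<^sup>2 - 2 * (a \<bullet> b) + (norm b)\<^sup>2"
        by (simp add: power2_norm_eq_inner inner_diff_left inner_diff_right inner_commute)
      moreover have "(a - b) \<bullet> b = a \<bullet> b - (norm b)\<^sup>2"
        by (simp add: power2_norm_eq_inner inner_diff_left)
      ultimately show ?thesis by algebra
    qed
    from this[of "s - e" "s - q"] show ?thesis by simp
  qed
  finally show ?thesis
    using assms by (simp add: real_sqrt_divide)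
qed

text \<open>The nadir angle at the satellite depends only on where the line of sight crosses the
  plane, and its sine is \<open>d / sqrt (d\<^sup>2 + h\<^sup>2)\<close>; the factor
  \<open>(r + h) / r\<close> comes from the law of sines.\<close>

lemma cos_elevation_angle_line_of_sight:
  fixes p o' :: plane
  assumes "h > 0" "r > 0" "dist (o', - r) q = r" "(p, 0) \<in> closed_segment (o', h) q"
  shows "cos (elevation_angle (o', - r) q (o', h)) =
    (r + h) / r * (dist p o' / sqrt ((dist p o')\<^sup>2 + h\<^sup>2))"
proof -
  define d where "d = dist p o'"
  obtain t where t: "0 \<le> t" "(p, 0) = (1 - t) *\<^sub>R (o', h) + t *\<^sub>R q"
    using assms(4) by (auto simp: closed_segment_def)
  \<comment> \<open>For \<open>t = 0\<close> the crossing point would be the satellite itself, at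
    height \<open>h > 0\<close> instead of 0.\<close>
  have "t \<noteq> 0" using t(2) \<open>h > 0\<close> by (auto simp: prod_eq_iff)
  with t have "t > 0" by simp
  have "(o', h) - (p, 0) = t *\<^sub>R ((o', h) - q)"
    using t(2) by (simp add: algebra_simps prod_eq_iff)
  \<comment> \<open>Up to the factor \<open>1 / t\<close> the line of sight is the vector from the
    crossing point to the satellite; this factor cancels in the quotient.\<close>
  then have v: "(o', h) - q = (1 / t) *\<^sub>R (o' - p, h)"
    using \<open>t > 0\<close> by simp
  have n: "norm (o' - p, h) = sqrt (d\<^sup>2 + h\<^sup>2)"
    by (simp add: norm_Pair d_def dist_norm norm_minus_commute)
  have pos: "sqrt (d\<^sup>2 + h\<^sup>2) > 0"
    using \<open>h > 0\<close> by (simp add: add_nonneg_pos)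
  have ne: "q \<noteq> (o', - r)" "(o', h) \<noteq> q"
    using assms(3) \<open>r > 0\<close> v \<open>t > 0\<close> \<open>h > 0\<close> by (auto simp: zero_prod_def)
  have "(norm ((o', h) - (o', - r)))\<^sup>2 = (r + h)\<^sup>2"
    by (simp add: norm_Pair add.commute)
  moreover have "((o', h) - (o', - r)) \<bullet> ((o', h) - q) = (r + h) * h / t"
    unfolding v by (simp add: add.commute)
  moreover have nq: "norm ((o', h) - q) = sqrt (d\<^sup>2 + h\<^sup>2) / t"
    unfolding v norm_scaleR n using \<open>t > 0\<close> by simp
  moreover have "norm (q - (o', - r)) = r"
    using assms(3) by (simp add: dist_norm norm_minus_commute)
  moreover have "(r + h)\<^sup>2 * (sqrt (d\<^sup>2 + h\<^sup>2) / t)\<^sup>2 - ((r + h) * h / t)\<^sup>2 = ((r + h) * d / t)\<^sup>2"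
  proof -
    have "(sqrt (d\<^sup>2 + h\<^sup>2))\<^sup>2 = d\<^sup>2 + h\<^sup>2" by simp
    then show ?thesis
      unfolding power_divide
      by (simp add: power2_eq_square algebra_simps add_divide_distrib)
  qed
  ultimately have "cos (elevation_angle (o', - r) q (o', h)) =
      sqrt (((r + h) * d / t)\<^sup>2) / (r * (sqrt (d\<^sup>2 + h\<^sup>2) / t))"
    using cos_elevation_angle[OF ne] by simp
  also have "\<dots> = (r + h) / r * (d / sqrt (d\<^sup>2 + h\<^sup>2))"
    using \<open>t > 0\<close> \<open>h > 0\<close> \<open>r > 0\<close> pos by (simp add: d_def abs_mult)
  finally show ?thesis by (simp add: d_def)
qed

lemma mult_sin_nadir_le_iff:
  fixes A d h x :: real
  assumes "\<bar>x\<bar> < \<bar>A\<bar>" "h > 0" "d \<ge> 0"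
  shows "\<bar>A\<bar> * (d / sqrt (d\<^sup>2 + h\<^sup>2)) \<le> x \<longleftrightarrow> d \<le> h * x / sqrt (A\<^sup>2 - x\<^sup>2)"
proof -
  have lt: "x\<^sup>2 < A\<^sup>2"
    using assms(1) abs_le_square_iff[of A x] by linarith
  then have pos: "sqrt (d\<^sup>2 + h\<^sup>2) > 0" "sqrt (A\<^sup>2 - x\<^sup>2) > 0"
    using \<open>h > 0\<close> by (simp_all add: add_nonneg_pos)
  show ?thesis
  proof (cases "x \<ge> 0")
    case True
    have "\<bar>A\<bar> * (d / sqrt (d\<^sup>2 + h\<^sup>2)) \<le> x \<longleftrightarrow> \<bar>A\<bar> * d \<le> x * sqrt (d\<^sup>2 + h\<^sup>2)"
      using pos by (simp add: field_simps)
    also have "\<dots> \<longleftrightarrow> (\<bar>A\<bar> * d)\<^sup>2 \<le> (x * sqrt (d\<^sup>2 + h\<^sup>2))\<^sup>2"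
      using True \<open>d \<ge> 0\<close> by (intro power_mono_iff[symmetric]) auto
    \<comment> \<open>The term \<open>x\<^sup>2 * d\<^sup>2\<close> moves to the left, which
      collects \<open>d\<close> there.\<close>
    also have "\<dots> \<longleftrightarrow> (d * sqrt (A\<^sup>2 - x\<^sup>2))\<^sup>2 \<le> (h * x)\<^sup>2"
      using lt by (simp add: power_mult_distrib algebra_simps)
    also have "\<dots> \<longleftrightarrow> d * sqrt (A\<^sup>2 - x\<^sup>2) \<le> h * x"
      using True \<open>d \<ge> 0\<close> \<open>h > 0\<close> lt by (intro power_mono_iff) auto
    also have "\<dots> \<longleftrightarrow> d \<le> h * x / sqrt (A\<^sup>2 - x\<^sup>2)"
      using pos by (simp add: field_simps)
    finally show ?thesis .
  \<comment> \<open>For \<open>x < 0\<close> both inequalities fail: the left one bounds a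
    nonnegative number by \<open>x\<close>, the right one bounds \<open>d\<close> by a negative
    radius.\<close>
  next
    case False
    have "h * x / sqrt (A\<^sup>2 - x\<^sup>2) < 0"
      using False \<open>h > 0\<close> pos by (simp add: divide_neg_pos mult_pos_neg)
    moreover have "\<bar>A\<bar> * (d / sqrt (d\<^sup>2 + h\<^sup>2)) \<ge> 0"
      using pos \<open>d \<ge> 0\<close> by simp
    ultimately show ?thesis using False \<open>d \<ge> 0\<close> by linarith
  qed
qed

text \<open>Identifies \<open>F_M\<close> with the distance law for an arbitrary cluster and
  reference point: both reduce to the same normalized area of a lens.\<close>

lemma measure_dist_uniform_disc:
  fixes X :: "'a \<Rightarrow> plane"
  assumes "R > 0" "X \<in> borel_measurable M" "distr M borel X = uniform_measure lborel (cball a R)"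
  shows "measure M {w \<in> space M. dist (X w) b \<le> r} = F_M r R (dist a b)"
proof -
  have "{w \<in> space M. dist (X w) b \<le> r} = X -` cball b r \<inter> space M"
    by (auto simp: dist_commute)
  then have "measure M {w \<in> space M. dist (X w) b \<le> r} = measure (distr M borel X) (cball b r)"
    using assms(2) by (simp add: measure_distr)
  also have "\<dots> = measure lborel (cball a R \<inter> cball b r) / (pi * R\<^sup>2)"
    unfolding assms(3) using \<open>R > 0\<close>
    by (subst measure_uniform_measure) (auto simp: emeasure_cball content_cball eval_unit_ball_vol)
  also have "\<dots> = F_M r R (dist a b)"
    using F_M_eq_measure[OF \<open>R > 0\<close>, of a b "dist a b" r] by simp
  finally show ?thesis .
qed

theorem theorem1:
  fixes M :: "'a measure"
    and X :: "'a \<Rightarrow> plane"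
    and Q :: "'a \<Rightarrow> space"
    and chi :: "'a \<Rightarrow> real"
    and subsat center :: plane
    and sat earth :: space
    and f_c c h r_E r_o \<omega>_s \<omega>_E \<omega>_F \<theta>_i \<rho> s A Rhat :: real
  assumes "prob_space M"
    and "f_c > 0" "c > 0" "h > 0" "r_E > 0" "\<rho> > 0"
    and "r_o = r_E + h"
    and "\<omega>_F = \<omega>_s + \<omega>_E * cos \<theta>_i"
    \<comment> \<open>satellite at altitude \<open>h\<close> above its projection on P, earth centre \<open>r_o\<close> below the satellite\<close>
    and "sat = (subsat, h)"
    and "earth = (subsat, - r_E)"
    and "s = dist sat (center, 0)"
    \<comment> \<open>the planar location of the UE is uniform in the cluster\<close>
    and "X \<in> borel_measurable M"
    and "\<And>w. w \<in> space M \<Longrightarrow> X w \<in> cball center \<rho>"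
    and "distr M borel X = uniform_measure lborel (cball center \<rho>)"
    \<comment> \<open>the UE lies on the earth surface and \<open>X\<close> is where its line of sight to the satellite meets P\<close>
    and "\<And>w. w \<in> space M \<Longrightarrow> dist earth (Q w) = r_E"
    and "\<And>w. w \<in> space M \<Longrightarrow> (X w, 0) \<in> closed_segment sat (Q w)"
    and "\<And>w. w \<in> space M \<Longrightarrow>
           chi w = doppler_shift f_c c r_E \<omega>_F (elevation_angle earth (Q w) sat)"
    and "A = f_c * r_o * (\<omega>_s + \<omega>_E * cos \<theta>_i) / c"
    and "Rhat = sqrt (s\<^sup>2 - h\<^sup>2)"
  shows "(\<forall>x. \<bar>x\<bar> < \<bar>A\<bar> \<longrightarrow>
            measure M {w \<in> space M. \<bar>chi w\<bar> \<le> x} = F_M (h * x / sqrt (A\<^sup>2 - x\<^sup>2)) \<rho> Rhat)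
       \<and> (\<forall>r R Rh. R > 0 \<and> Rh \<ge> 0 \<and> 0 \<le> r \<and> r \<le> R - Rh \<longrightarrow>
            F_M r R Rh = r\<^sup>2 / R\<^sup>2)
       \<and> (\<forall>r R Rh. R > 0 \<and> Rh \<ge> 0 \<and> \<bar>R - Rh\<bar> < r \<and> r \<le> R + Rh \<longrightarrow>
            F_M r R Rh =
              r\<^sup>2 / (pi * R\<^sup>2) * (theta_star r R Rh - 1 / 2 * sin (2 * theta_star r R Rh))
              + 1 / pi * (phi_star r R Rh - 1 / 2 * sin (2 * phi_star r R Rh)))"
proof (intro conjI allI impI)
  fix x assume x: "\<bar>x\<bar> < \<bar>A\<bar>"
  \<comment> \<open>Pythagoras: the slant range is the hypotenuse over the height \<open>h\<close>
    and the planar distance.\<close>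
  have Rhat: "Rhat = dist center subsat"
    using assms(9,11,19) by (simp add: dist_Pair_Pair dist_commute dist_real_def)
  have "\<bar>chi w\<bar> = \<bar>A\<bar> * (dist (X w) subsat / sqrt ((dist (X w) subsat)\<^sup>2 + h\<^sup>2))" if "w \<in> space M" for w
  proof -
    have cos: "cos (elevation_angle earth (Q w) sat) =
        r_o / r_E * (dist (X w) subsat / sqrt ((dist (X w) subsat)\<^sup>2 + h\<^sup>2))"
      using cos_elevation_angle_line_of_sight[of h r_E subsat "Q w" "X w"] assms(4,5,7,9,10,15,16) that
      by simp
    \<comment> \<open>The factor \<open>r_E\<close> of the Doppler formula cancels against
      \<open>r_o / r_E\<close>, which is how \<open>r_o\<close> enters \<open>A\<close>. The sign of
      \<open>A\<close> is open, hence \<open>\<bar>A\<bar>\<close> in the magnitude.\<close>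
    have "chi w = - (A * (dist (X w) subsat / sqrt ((dist (X w) subsat)\<^sup>2 + h\<^sup>2)))"
      using assms(17)[OF that] assms(5) unfolding cos doppler_shift_def assms(8,18) by (simp add: mult_ac)
    then show ?thesis by (simp add: abs_mult)
  qed
  then have "{w \<in> space M. \<bar>chi w\<bar> \<le> x} = {w \<in> space M. dist (X w) subsat \<le> h * x / sqrt (A\<^sup>2 - x\<^sup>2)}"
    using mult_sin_nadir_le_iff[OF x assms(4)] by auto
  then show "measure M {w \<in> space M. \<bar>chi w\<bar> \<le> x} = F_M (h * x / sqrt (A\<^sup>2 - x\<^sup>2)) \<rho> Rhat"
    using measure_dist_uniform_disc[OF assms(6,12,14)] by (simp add: Rhat)
next
  fix r R Rh :: real
  assume "R > 0 \<and> Rh \<ge> 0 \<and> 0 \<le> r \<and> r \<le> R - Rh"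
  then show "F_M r R Rh = r\<^sup>2 / R\<^sup>2"
    using F_M_inner by simp
next
  fix r R Rh :: real
  assume "R > 0 \<and> Rh \<ge> 0 \<and> \<bar>R - Rh\<bar> < r \<and> r \<le> R + Rh"
  then show "F_M r R Rh =
      r\<^sup>2 / (pi * R\<^sup>2) * (theta_star r R Rh - 1 / 2 * sin (2 * theta_star r R Rh))
      + 1 / pi * (phi_star r R Rh - 1 / 2 * sin (2 * phi_star r R Rh))"
    by (intro F_M_lens) simp_all
qed

end
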